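(* Let $S$ be a Noetherian commutative ring, and let $\mathfrak{a}_\bullet$ and $\mathfrak{b}_\bullet$ be filtrations of ideals in $S$. Suppose that $\mathcal{R}(\overline{\mathfrak{b}_\bullet})$ is a finitely generated $\mathcal{R}(\mathfrak{b}_\bullet)$-module. Then $$\widehat{\rho}(\mathfrak{a}_\bullet,\overline{\mathfrak{b}_\bullet})=\widehat{\rho}(\mathfrak{a}_\bullet,\mathfrak{b}_\bullet).$$
   Context: $\mathbb{N}$ denotes the positive integers. A graded family of ideals in $S$ is a collection $\mathfrak{a}_\bullet=\{\mathfrak{a}_i\}_{i\ge 1}$ of ideals with $\mathfrak{a}_p\mathfrak{a}_q\subseteq\mathfrak{a}_{p+q}$ for all $p,q\ge 1$ (convention: $\mathfrak{a}_0=S$). It is a filtration if in addition $\mathfrak{a}_p\supseteq\mathfrak{a}_{p+1}$ for all $p\ge1$. The Rees algebra is $\mathcal{R}(\mathfrak{a}_\bullet)=\bigoplus_{n\ge0}\mathfrak{a}_nt^n\subseteq S[t]$. $\overline{\mathfrak{b}_\bullet}=\{\overline{\mathfrak{b}_i}\}_{i\ge1}$ is the family of integral closures. The asymptotic resurgence number of graded families is $$\widehat{\rho}(\mathfrak{a}_\bullet,\mathfrak{b}_\bullet)=\sup\left\{\tfrac{s}{r} \mid s,r\in\mathbb{N},\ \mathfrak{a}_{st}\not\subseteq\mathfrak{b}_{rt}\text{ for all sufficiently large } t\right\},$$ with values in the extended reals and $\sup\varnothing=-\infty$. *)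

theory Defs
  imports
    "HOL-Algebra.Ideal_Product"
    "HOL-Algebra.Ring_Divisibility"
    "HOL-Algebra.UnivPoly"
    "HOL-Library.Extended_Real"
begin

text \<open>
  Families of ideals are indexed by the positive integers.  They are represented by functions on
  \<^typ>\<open>nat\<close> whose value at \<open>0\<close> is irrelevant: no definition below depends on it, and the
  convention \<open>\<aa>\<^sub>0 = S\<close> is built into the Rees algebra.
\<close>

locale graded_family = cring S for S (structure) +
  fixes a :: "nat \<Rightarrow> 'a set"
  assumes ideal: "0 < p \<Longrightarrow> ideal (a p) S"
    and mult_subset: "\<lbrakk> 0 < p; 0 < q \<rbrakk> \<Longrightarrow> ideal_prod S (a p) (a q) \<subseteq> a (p + q)"

locale ideal_filtration = graded_family +
  assumes decreasing: "0 < p \<Longrightarrow> a (Suc p) \<subseteq> a p"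

text \<open>
  An element \<open>x\<close> is integral over \<open>I\<close> if
  \<open>x\<^sup>n + c\<^sub>1 x\<^bsup>n-1\<^esup> + \<dots> + c\<^sub>n = 0\<close> for some \<open>n \<ge> 1\<close> and \<open>c\<^sub>i \<in> I\<^sup>i\<close>.
  The power \<open>I\<^sup>i\<close> is the one in the multiplicative monoid of ideals of \<open>S\<close>.
\<close>

definition ideal_integral_closure :: "('a, 'm) ring_scheme \<Rightarrow> 'a set \<Rightarrow> 'a set" where
  "ideal_integral_closure S I =
    {x \<in> carrier S. \<exists>(n::nat) c. 0 < n \<and>
        (\<forall>i \<in> {1..n}. c i \<in> I [^]\<^bsub>ideals_set S\<^esub> i) \<and>
        x [^]\<^bsub>S\<^esub> n \<oplus>\<^bsub>S\<^esub> (\<Oplus>\<^bsub>S\<^esub>i \<in> {1..n}. c i \<otimes>\<^bsub>S\<^esub> x [^]\<^bsub>S\<^esub> (n - i)) = \<zero>\<^bsub>S\<^esub>}"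

definition closure_family :: "('a, 'm) ring_scheme \<Rightarrow> (nat \<Rightarrow> 'a set) \<Rightarrow> nat \<Rightarrow> 'a set" where
  "closure_family S b = (\<lambda>i. ideal_integral_closure S (b i))"

text \<open>The degree \<open>0\<close> coefficient is unconstrained because \<open>\<aa>\<^sub>0 = S\<close>.\<close>

definition rees_algebra ::
    "('a, 'm) ring_scheme \<Rightarrow> (nat \<Rightarrow> 'a set) \<Rightarrow> ('a, nat \<Rightarrow> 'a) up_ring" where
  "rees_algebra S a =
    (UP S)\<lparr>carrier := {f \<in> carrier (UP S). \<forall>n > 0. coeff (UP S) f n \<in> a n}\<rparr>"

text \<open>
  The record \<open>rees_algebra S a\<close> inherits from \<^const>\<open>UP\<close> the scalar multiplication by elements
  of \<open>S\<close>.  Here the scalars are instead polynomials, acting by multiplication in \<open>S[t]\<close>.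
\<close>

definition rees_module ::
    "('a, 'm) ring_scheme \<Rightarrow> (nat \<Rightarrow> 'a set) \<Rightarrow> (nat \<Rightarrow> 'a, nat \<Rightarrow> 'a) module" where
  "rees_module S a =
    \<lparr>carrier = carrier (rees_algebra S a),
     monoid.mult = monoid.mult (rees_algebra S a),
     one = one (rees_algebra S a),
     zero = zero (rees_algebra S a),
     add = add (rees_algebra S a),
     smult = monoid.mult (UP S)\<rparr>"

locale finitely_generated_module = module +
  assumes finitely_generated:
    "\<exists>G. finite G \<and> G \<subseteq> carrier M \<and>
      (\<forall>x \<in> carrier M. \<exists>c \<in> G \<rightarrow> carrier R. x = (\<Oplus>\<^bsub>M\<^esub>g \<in> G. c g \<odot>\<^bsub>M\<^esub> g))"

text \<open>In \<^typ>\<open>ereal\<close> the supremum of the empty set is \<open>-\<infinity>\<close>.\<close>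

definition asymptotic_resurgence :: "(nat \<Rightarrow> 'a set) \<Rightarrow> (nat \<Rightarrow> 'a set) \<Rightarrow> ereal" where
  "asymptotic_resurgence a b =
    Sup {ereal (real s / real r) | s r. 0 < s \<and> 0 < r \<and>
      (\<forall>\<^sub>F t in sequentially. \<not> a (s * t) \<subseteq> b (r * t))}"

end

theory Submission
  imports Defs "HOL-Real_Asymp.Real_Asymp"
begin

text \<open>
  Write \<open>c\<^sub>n\<close> for the integral closure of \<open>b\<^sub>n\<close>.  If the module
  generators have degree at most \<open>K\<close>, comparing coefficients gives
  \<open>b\<^sub>n \<subseteq> c\<^sub>n \<subseteq> b\<^bsub>n-K\<^esub>\<close> for \<open>n > K\<close>.
  If \<open>a\<^bsub>st\<^esub>\<close> is not contained in \<open>b\<^bsub>rt\<^esub>\<close> for large \<open>t\<close>, then for every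
  \<open>m > 0\<close> and all large \<open>t\<close>, \<open>a\<^bsub>smt\<^esub>\<close> is not contained in
  \<open>c\<^bsub>(rm+1)t\<^esub>\<close>, since \<open>(rm+1)t - K \<ge> rmt\<close> once \<open>t \<ge> K\<close>.
  The ratios \<open>sm / (rm+1)\<close> tend to \<open>s / r\<close>.
\<close>

lemma (in ideal) finsum_closed_ideal:
  assumes "finite A" "\<And>i. i \<in> A \<Longrightarrow> f i \<in> I"
  shows "finsum R f A \<in> I"
  using assms
proof (induction A rule: finite_induct)
  case (insert x F)
  then have "f \<in> F \<rightarrow> carrier R" "f x \<in> carrier R"
    using Icarr by auto
  with insert show ?case by simp
qed simp

text \<open>Each \<open>x\<close> in \<open>I\<close> is a root of the monic linear polynomial X -
  x, so degree 1 with \<open>c 1\<close> equal to \<open>\<ominus> x\<close> suffices.\<close>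

lemma (in cring) ideal_subset_integral_closure:
  assumes "ideal I R"
  shows "I \<subseteq> ideal_integral_closure R I"
proof
  fix x assume x: "x \<in> I"
  interpret I: ideal I R by fact
  have xR: "x \<in> carrier R" using x I.Icarr by blast
  \<comment> \<open>The first power unfolds to the unit of the monoid of ideals, which is
    \<open>carrier R\<close>, times \<open>I\<close>.\<close>
  have "I [^]\<^bsub>ideals_set R\<^esub> (1::nat) = carrier R \<cdot>\<^bsub>R\<^esub> I"
    by (simp add: nat_pow_def ideals_set_def)
  also have "\<dots> = I"
    using ideal_prod_commute[OF oneideal assms] ideal_prod_one[OF assms] by simp
  finally have "\<ominus> x \<in> I [^]\<^bsub>ideals_set R\<^esub> (1::nat)"
    using x by simp
  moreover have "x [^] (1::nat) \<oplus> (\<Oplus>i \<in> {1..1::nat}. \<ominus> x \<otimes> x [^] (1 - i)) = \<zero>"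
    using xR by (simp add: r_neg)
  ultimately show "x \<in> ideal_integral_closure R I"
    unfolding ideal_integral_closure_def using xR
    by (auto intro!: exI[of _ "1::nat"] exI[of _ "\<lambda>_. \<ominus> x"])
qed

lemma (in ideal_filtration) antimono:
  assumes "0 < p" "p \<le> q"
  shows "a q \<subseteq> a p"
  using assms(2)
proof (induction q rule: dec_induct)
  case (step n)
  then show ?case using decreasing[of n] assms(1) by auto
qed simp

text \<open>Take \<open>K\<close> bounding the degrees of the generators. In the coefficient of
  degree \<open>n\<close> of a product \<open>d g\<close> times \<open>g\<close>, a term survives
  only if \<open>g\<close> contributes degree at most \<open>K\<close>; then \<open>d g\<close>
  contributes degree at least \<open>n - K\<close>, and its coefficient lies in
  \<open>a (n - K)\<close>.\<close>

lemma (in ideal_filtration) coeff_finitely_generated_rees_module: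
  assumes "finitely_generated_module (rees_algebra S a) (rees_module S c)"
  obtains K where
    "\<And>f n. \<lbrakk> f \<in> carrier (rees_module S c); K < n \<rbrakk> \<Longrightarrow> coeff (UP S) f n \<in> a (n - K)"
proof -
  let ?R = "rees_algebra S a" and ?M = "rees_module S c"
  interpret U: UP_cring S "UP S" by unfold_locales
  interpret M: finitely_generated_module ?R ?M by fact
  have MU: "carrier ?M \<subseteq> carrier (UP S)" and RU: "carrier ?R \<subseteq> carrier (UP S)"
    by (auto simp: rees_module_def rees_algebra_def)
  have R_coeff: "coeff (UP S) f n \<in> a n" if "f \<in> carrier ?R" "0 < n" for f n
    using that by (auto simp: rees_algebra_def)
  obtain G where G: "finite G" "G \<subseteq> carrier ?M"
    and gen: "\<And>f. f \<in> carrier ?M \<Longrightarrow> \<exists>c \<in> G \<rightarrow> carrier ?R. f = (\<Oplus>\<^bsub>?M\<^esub>g \<in> G. c g \<odot>\<^bsub>?M\<^esub> g)"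
    using M.finitely_generated by blast
  \<comment> \<open>Inserting 0 keeps \<open>Max\<close> meaningful when \<open>G\<close> is
    empty.\<close>
  define K where "K = Max (insert 0 (deg S ` G))"
  have vanish: "coeff (UP S) g j = \<zero>" if "g \<in> G" "K < j" for g j
  proof (rule U.deg_aboveD)
    have "deg S g \<le> K" using G(1) that(1) by (simp add: K_def)
    then show "deg S g < j" using that(2) by simp
    show "g \<in> carrier (UP S)" using that(1) G(2) MU by blast
  qed
  have "coeff (UP S) f n \<in> a (n - K)" if f: "f \<in> carrier ?M" and n: "K < n" for f n
  proof -
    interpret I: ideal "a (n - K)" S using n by (intro ideal) simp
    obtain d where d: "d \<in> G \<rightarrow> carrier ?R" and fd: "f = (\<Oplus>\<^bsub>?M\<^esub>g \<in> G. d g \<odot>\<^bsub>?M\<^esub> g)"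
      using gen[OF f] by blast
    have term_mem: "coeff (UP S) (d g \<odot>\<^bsub>?M\<^esub> g) n \<in> a (n - K)" if g: "g \<in> G" for g
    proof -
      have dR: "d g \<in> carrier ?R" using d g by blast
      then have dU: "d g \<in> carrier (UP S)" and gU: "g \<in> carrier (UP S)"
        using RU MU G(2) g by blast+
      have "coeff (UP S) (d g) i \<otimes> coeff (UP S) g (n - i) \<in> a (n - K)" if i: "i \<le> n" for i
      proof (cases "K < n - i")
        case True
        then show ?thesis using vanish[OF g True] dU by simp
      next
        case False
        \<comment> \<open>Positivity matters: it gives \<open>0 < i\<close>, and only coefficients
          of positive degree are constrained in the Rees algebra.\<close>
        then have "0 < n - K" "n - K \<le> i" using n i by auto
        then have "coeff (UP S) (d g) i \<in> a (n - K)"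
          using R_coeff[OF dR, of i] antimono[of "n - K" i] by auto
        then show ?thesis using gU by (simp add: I.I_r_closed)
      qed
      then have "(\<Oplus>i \<in> {..n}. coeff (UP S) (d g) i \<otimes> coeff (UP S) g (n - i)) \<in> a (n - K)"
        by (intro I.finsum_closed_ideal) auto
      then show ?thesis
        using dU gU by (simp add: rees_module_def U.coeff_mult)
    qed
    have dM: "d g \<odot>\<^bsub>?M\<^esub> g \<in> carrier ?M" if "g \<in> G" for g
      using d G(2) that by (intro M.smult_closed) auto
    \<comment> \<open>The sum is formed in \<open>?M\<close>, not in \<open>UP S\<close>. The two
      records share zero and addition, so induction on \<open>F\<close> carries the coefficient
      through the sum.\<close>
    have "coeff (UP S) (\<Oplus>\<^bsub>?M\<^esub>g \<in> F. d g \<odot>\<^bsub>?M\<^esub> g) n \<in> a (n - K)" if "finite F" "F \<subseteq> G" for F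
      using that
    proof (induction F rule: finite_induct)
      case empty
      have "\<zero>\<^bsub>?M\<^esub> = \<zero>\<^bsub>UP S\<^esub>" by (simp add: rees_module_def rees_algebra_def)
      then show ?case by simp
    next
      case (insert x F)
      let ?s = "\<Oplus>\<^bsub>?M\<^esub>g \<in> F. d g \<odot>\<^bsub>?M\<^esub> g"
      have clo: "(\<lambda>g. d g \<odot>\<^bsub>?M\<^esub> g) \<in> F \<rightarrow> carrier ?M" "d x \<odot>\<^bsub>?M\<^esub> x \<in> carrier ?M"
        using dM insert.prems by auto
      then have "?s \<in> carrier (UP S)" "d x \<odot>\<^bsub>?M\<^esub> x \<in> carrier (UP S)"
        using MU by auto
      moreover have "(\<Oplus>\<^bsub>?M\<^esub>g \<in> insert x F. d g \<odot>\<^bsub>?M\<^esub> g) = d x \<odot>\<^bsub>?M\<^esub> x \<oplus>\<^bsub>UP S\<^esub> ?s"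
        using M.finsum_insert[of F x "\<lambda>g. d g \<odot>\<^bsub>?M\<^esub> g", OF insert.hyps clo]
        by (simp add: rees_module_def rees_algebra_def)
      ultimately show ?case
        using insert term_mem[of x] by (simp add: I.a_closed)
    qed
    then show ?thesis using G(1) fd by blast
  qed
  then show ?thesis using that by blast
qed

text \<open>The coefficient bound is applied to the monomials \<open>monom (UP S) x n\<close> with
  \<open>x\<close> in \<open>c n\<close>. Their other coefficients vanish, which is why
  \<open>c\<close> must contain zero in positive degrees.\<close>

lemma (in ideal_filtration) shift_subset_of_finitely_generated:
  assumes "finitely_generated_module (rees_algebra S a) (rees_module S c)"
    and "\<And>n. 0 < n \<Longrightarrow> \<zero> \<in> c n" and "\<And>n. c n \<subseteq> carrier S"
  obtains K where "\<And>n. K < n \<Longrightarrow> c n \<subseteq> a (n - K)"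
proof -
  interpret U: UP_cring S "UP S" by unfold_locales
  obtain K where K:
    "\<And>f n. \<lbrakk> f \<in> carrier (rees_module S c); K < n \<rbrakk> \<Longrightarrow> coeff (UP S) f n \<in> a (n - K)"
    using coeff_finitely_generated_rees_module[OF assms(1)] by blast
  have "x \<in> a (n - K)" if "K < n" "x \<in> c n" for n x
  proof -
    have x: "x \<in> carrier S" using assms(3) that(2) by blast
    then have "monom (UP S) x n \<in> carrier (rees_module S c)"
      using assms(2) that(2) by (simp add: rees_module_def rees_algebra_def)
    from K[OF this that(1)] x show ?thesis by simp
  qed
  then show ?thesis using that by blast
qed

lemma asymptotic_resurgence_antimono:
  assumes "\<And>n. 0 < n \<Longrightarrow> b n \<subseteq> c n"
  shows "asymptotic_resurgence a c \<le> asymptotic_resurgence a b"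
  unfolding asymptotic_resurgence_def
proof (rule Sup_subset_mono, safe)
  fix s r :: nat
  assume sr: "0 < s" "0 < r" and ev: "\<forall>\<^sub>F t in sequentially. \<not> a (s * t) \<subseteq> c (r * t)"
  have "\<forall>\<^sub>F t in sequentially. \<not> a (s * t) \<subseteq> b (r * t)"
    using ev eventually_gt_at_top[of 0]
  proof eventually_elim
    case (elim t)
    then show ?case using assms[of "r * t"] sr by auto
  qed
  then show "\<exists>s' r'. ereal (real s / real r) = ereal (real s' / real r') \<and> 0 < s' \<and> 0 < r' \<and>
      (\<forall>\<^sub>F t in sequentially. \<not> a (s' * t) \<subseteq> b (r' * t))"
    using sr by blast
qed

text \<open>Replacing \<open>r\<close> by \<open>r + 1/m\<close> and clearing denominators makes the
  index of \<open>c\<close> exceed that of \<open>b\<close> by \<open>t\<close>, which eventually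
  absorbs the fixed shift \<open>K\<close>. The loss in the ratio disappears as \<open>m\<close>
  grows.\<close>

lemma asymptotic_resurgence_le_of_shift:
  assumes shift: "\<And>n. K < n \<Longrightarrow> c n \<subseteq> b (n - K)"
    and anti: "\<And>p q. \<lbrakk> 0 < p; p \<le> q \<rbrakk> \<Longrightarrow> b q \<subseteq> b p"
  shows "asymptotic_resurgence a b \<le> asymptotic_resurgence a c"
  unfolding asymptotic_resurgence_def [of a b]
proof (rule Sup_least, safe)
  fix s r :: nat
  assume s: "0 < s" and r: "0 < r" and ev: "\<forall>\<^sub>F t in sequentially. \<not> a (s * t) \<subseteq> b (r * t)"
  have le: "ereal (real (s * m) / real (r * m + 1)) \<le> asymptotic_resurgence a c" if m: "0 < m" for m
  proof -
    \<comment> \<open>Non-containment for all large indices persists along the multiples of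
      \<open>m\<close>.\<close>
    have "filterlim (\<lambda>t. m * t) sequentially sequentially"
      using m by (intro filterlim_subseq) (simp add: strict_mono_def)
    with ev have "\<forall>\<^sub>F t in sequentially. \<not> a (s * (m * t)) \<subseteq> b (r * (m * t))"
      by (rule eventually_compose_filterlim)
    then have "\<forall>\<^sub>F t in sequentially. \<not> a (s * m * t) \<subseteq> c ((r * m + 1) * t)"
      using eventually_gt_at_top[of K]
    proof eventually_elim
      case (elim t)
      have pos: "0 < r * (m * t)" using r m elim by simp
      \<comment> \<open>Both follow from \<open>K < t\<close>, since \<open>(r * m + 1) * t\<close>
        is \<open>r * m * t + t\<close>.\<close>
      have ge: "r * (m * t) \<le> (r * m + 1) * t - K" and gt: "K < (r * m + 1) * t"
        using elim by (simp_all add: algebra_simps)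
      have "c ((r * m + 1) * t) \<subseteq> b (r * (m * t))"
        using shift[OF gt] anti[OF pos ge] by blast
      then show ?case using elim by (auto simp: mult.assoc)
    qed
    then show ?thesis
      unfolding asymptotic_resurgence_def using s m
      by (intro Sup_upper CollectI exI[of _ "s * m"] exI[of _ "r * m + 1"]) simp
  qed
  have "(\<lambda>m. real (s * m) / real (r * m + 1)) \<longlonglongrightarrow> real s / real r"
    using r unfolding divide_inverse by real_asymp
  then have "(\<lambda>m. ereal (real (s * m) / real (r * m + 1))) \<longlonglongrightarrow> ereal (real s / real r)"
    by simp
  then show "ereal (real s / real r) \<le> asymptotic_resurgence a c"
    \<comment> \<open>The bound \<open>le\<close> holds from \<open>m = 1\<close> on, hence the
      witness 1.\<close>
    by (rule LIMSEQ_le_const2) (use le in \<open>auto intro!: exI[of _ 1]\<close>)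
qed

theorem corollary3p9:
  fixes S :: "('a, 'm) ring_scheme" and a b :: "nat \<Rightarrow> 'a set"
  assumes "cring S" and "noetherian_ring S"
    and "ideal_filtration S a" and "ideal_filtration S b"
    and "finitely_generated_module (rees_algebra S b) (rees_module S (closure_family S b))"
  shows "asymptotic_resurgence a (closure_family S b) = asymptotic_resurgence a b"
proof -
  interpret b: ideal_filtration S b by fact
  have sub: "b n \<subseteq> closure_family S b n" if "0 < n" for n
    unfolding closure_family_def using b.ideal_subset_integral_closure[OF b.ideal[OF that]] .
  have zero: "\<zero>\<^bsub>S\<^esub> \<in> closure_family S b n" if "0 < n" for n
    using sub[OF that] additive_subgroup.zero_closed[OF ideal.axioms(1)[OF b.ideal[OF that]]] by blast
  have "closure_family S b n \<subseteq> carrier S" for n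
    by (auto simp: closure_family_def ideal_integral_closure_def)
  then obtain K where K: "\<And>n. K < n \<Longrightarrow> closure_family S b n \<subseteq> b (n - K)"
    using b.shift_subset_of_finitely_generated[OF assms(5) zero] by blast
  show ?thesis
  proof (rule antisym)
    show "asymptotic_resurgence a (closure_family S b) \<le> asymptotic_resurgence a b"
      using sub by (rule asymptotic_resurgence_antimono)
    show "asymptotic_resurgence a b \<le> asymptotic_resurgence a (closure_family S b)"
      using K b.antimono by (rule asymptotic_resurgence_le_of_shift)
  qed
qed

end
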